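(* Let $(\Omega,\mathcal{F},P)$ be a probability space and let $\boldsymbol{Y},\boldsymbol{X}\in Ln_2$. Then the $\sigma(\boldsymbol{X})$-measurable random variable in $Ln_2$ that minimizes the logarithmic distance $d_\ell$ to $\boldsymbol{Y}$ (among all $\sigma(\boldsymbol{X})$-measurable elements of $Ln_2$) is $$E_\ell[\boldsymbol{Y}|\boldsymbol{X}]=\exp\left(E[\ln\boldsymbol{Y}\,|\,\boldsymbol{X}]\right).$$ Moreover, $E_\ell[\boldsymbol{Y}|\boldsymbol{X}]\leq E[\boldsymbol{Y}\,|\,\boldsymbol{X}]$ componentwise, $P$-almost surely.
   Context: All operations and inequalities between vectors are componentwise, and random variables that are $P$-a.e. equal are identified. $\mathcal{C}$ denotes the set of $P$-a.e. finite and strictly positive ($(0,\infty)^n$-valued) random variables, and $Ln_2=\{\boldsymbol{X}\in\mathcal{C} : E[|\ln X_i|^2]<\infty,\ i=1,\dots,n\}$. The logarithmic distance between $\boldsymbol{X}_1,\boldsymbol{X}_2\in Ln_2$ is defined by $$d_\ell(\boldsymbol{X}_1,\boldsymbol{X}_2)^2=E\left[\sum_{i=1}^n\left(\ln X_1(i)-\ln X_2(i)\right)^2\right].$$ $E[\boldsymbol{Y}\,|\,\boldsymbol{X}]$ is the usual conditional expectation of a nonnegative random variable, taken componentwise and with values in $[0,\infty]$. *)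

theory Defs
  imports "HOL-Probability.Probability"
begin

text \<open>
  Random vectors are functions into \<^typ>\<open>real ^ 'n\<close>. Almost everywhere equal random vectors are
  not quotiented; equality of random vectors is stated as equality almost everywhere.
\<close>

text \<open>
  Almost everywhere finite random variables are represented by their real-valued versions. The
  positivity constraint is required only almost everywhere, so the totalized values of
  \<^const>\<open>ln\<close> outside the positive reals matter only on a null set.
\<close>

definition pos_rv :: "'a measure \<Rightarrow> ('a \<Rightarrow> real ^ 'n) set" where
  "pos_rv M = {X \<in> borel_measurable M. AE \<omega> in M. \<forall>i. 0 < X \<omega> $ i}"

definition Ln2 :: "'a measure \<Rightarrow> ('a \<Rightarrow> real ^ 'n) set" where
  "Ln2 M = {X \<in> pos_rv M. \<forall>i. integrable M (\<lambda>\<omega>. \<bar>ln (X \<omega> $ i)\<bar>\<^sup>2)}"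

definition log_dist :: "'a measure \<Rightarrow> ('a \<Rightarrow> real ^ 'n) \<Rightarrow> ('a \<Rightarrow> real ^ 'n) \<Rightarrow> real" where
  "log_dist M X1 X2 =
     sqrt (\<integral>\<omega>. (\<Sum>i\<in>UNIV. (ln (X1 \<omega> $ i) - ln (X2 \<omega> $ i))\<^sup>2) \<partial>M)"

definition sigma_gen :: "'a measure \<Rightarrow> ('a \<Rightarrow> real ^ 'n) \<Rightarrow> 'a measure" where
  "sigma_gen M X = vimage_algebra (space M) X borel"

definition log_cond_exp ::
  "'a measure \<Rightarrow> ('a \<Rightarrow> real ^ 'n) \<Rightarrow> ('a \<Rightarrow> real ^ 'n) \<Rightarrow> 'a \<Rightarrow> real ^ 'n" where
  "log_cond_exp M Y X \<omega> =
     (\<chi> i. exp (real_cond_exp M (sigma_gen M X) (\<lambda>\<omega>'. ln (Y \<omega>' $ i)) \<omega>))"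

end

theory Submission
  imports Defs
begin

text \<open>
  The logarithm turns the claim into two facts about ordinary conditional expectations, applied to
  each coordinate \<open>f = ln Y\<^sub>i\<close>, which is square integrable, and to \<open>F = \<sigma>(X)\<close>.

  First, \<open>m = E[f | F]\<close> is the orthogonal projection of \<open>f\<close> onto the square integrable
  \<open>F\<close>-measurable functions, so that \<open>E(f - g)\<^sup>2 = E(f - m)\<^sup>2 + E(m - g)\<^sup>2\<close> for each such function \<open>g\<close>
  (\<open>real_cond_exp_pythagoras\<close>). Summing over the coordinates gives a Pythagorean identity for the
  logarithmic distance (\<open>log_dist_pythagoras\<close>). It shows at once that \<open>exp m\<close> is a
  minimizer, and that any other minimizer is at logarithmic distance \<open>0\<close> from it, hence equal to it
  almost everywhere.

  Second, the inequality is the conditional Jensen inequality for the exponential function. Here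
  \<open>Y\<^sub>i = exp f\<close> need not be integrable, so its conditional expectation is one with values in
  \<open>[0, \<infinity>]\<close>. The proof (\<open>exp_real_cond_exp_le_nn_cond_exp\<close>) takes the conditional expectation of
  the tangent inequality \<open>1 + (f - m) \<le> exp (f - m)\<close>: the left-hand side has conditional
  expectation \<open>1\<close>, and on the right-hand side the \<open>F\<close>-measurable factor \<open>exp (- m)\<close> can be pulled
  out.
\<close>

section \<open>Conditional expectation as orthogonal projection\<close>

lemma integrable_mult_of_square_integrable:
  fixes f g :: "'a \<Rightarrow> real"
  assumes [measurable]: "f \<in> borel_measurable M" "g \<in> borel_measurable M"
    and "integrable M (\<lambda>x. (f x)\<^sup>2)" "integrable M (\<lambda>x. (g x)\<^sup>2)"
  shows "integrable M (\<lambda>x. f x * g x)"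
proof (rule Bochner_Integration.integrable_bound)
  show "integrable M (\<lambda>x. (f x)\<^sup>2 + (g x)\<^sup>2)"
    using assms by simp
  have "\<bar>a * b\<bar> \<le> a\<^sup>2 + b\<^sup>2" for a b :: real
  proof -
    have "2 * (\<bar>a\<bar> * \<bar>b\<bar>) \<le> a\<^sup>2 + b\<^sup>2"
      using sum_squares_bound[of "\<bar>a\<bar>" "\<bar>b\<bar>"] by simp
    moreover have "0 \<le> \<bar>a\<bar> * \<bar>b\<bar>"
      by simp
    ultimately show ?thesis
      unfolding abs_mult by linarith
  qed
  then show "AE x in M. norm (f x * g x) \<le> norm ((f x)\<^sup>2 + (g x)\<^sup>2)"
    by simp
qed simp

lemma integrable_square_diff:
  fixes f g :: "'a \<Rightarrow> real"
  assumes [measurable]: "f \<in> borel_measurable M" "g \<in> borel_measurable M"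
    and "integrable M (\<lambda>x. (f x)\<^sup>2)" "integrable M (\<lambda>x. (g x)\<^sup>2)"
  shows "integrable M (\<lambda>x. (f x - g x)\<^sup>2)"
  unfolding power2_diff
  using assms integrable_mult_of_square_integrable[OF assms] by (simp add: mult.assoc)

text \<open>
  Conditional Jensen for the square function bounds \<open>E[f | F]\<^sup>2\<close> by the integrable function
  \<open>E[f\<^sup>2 | F]\<close>.
\<close>

lemma (in finite_measure_subalgebra) integrable_real_cond_exp_square:
  assumes [measurable]: "f \<in> borel_measurable M" and sq: "integrable M (\<lambda>x. (f x)\<^sup>2)"
  shows "integrable M (\<lambda>x. (real_cond_exp M F f x)\<^sup>2)"
proof (rule integrable_convex_cond_exp[where q = power2 and I = UNIV])
  show "integrable M f"
    using square_integrable_imp_integrable[OF _ sq] by simp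
qed (use sq emeasure_finite in \<open>auto simp: convex_power2\<close>)

text \<open>
  The defining property of the conditional expectation makes the mixed term
  \<open>\<integral>(f - m) (m - g)\<close> vanish, because \<open>m - g\<close> is \<open>F\<close>-measurable.
\<close>

lemma (in finite_measure_subalgebra) real_cond_exp_pythagoras:
  fixes f g :: "'a \<Rightarrow> real"
  defines "m \<equiv> real_cond_exp M F f"
  assumes f: "f \<in> borel_measurable M" "integrable M (\<lambda>x. (f x)\<^sup>2)"
    and g: "g \<in> borel_measurable F" "integrable M (\<lambda>x. (g x)\<^sup>2)"
  shows "(\<integral>x. (f x - g x)\<^sup>2 \<partial>M) = (\<integral>x. (f x - m x)\<^sup>2 \<partial>M) + (\<integral>x. (m x - g x)\<^sup>2 \<partial>M)"
proof -
  have [measurable]: "f \<in> borel_measurable M" "g \<in> borel_measurable F" "g \<in> borel_measurable M"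
      "m \<in> borel_measurable F" "m \<in> borel_measurable M"
    using f g measurable_from_subalg[OF subalg] by (auto simp: m_def)
  have m: "integrable M (\<lambda>x. (m x)\<^sup>2)"
    unfolding m_def by (rule integrable_real_cond_exp_square[OF f])
  have sq: "integrable M (\<lambda>x. (f x - m x)\<^sup>2)" "integrable M (\<lambda>x. (m x - g x)\<^sup>2)"
    by (auto intro!: integrable_square_diff f g m)
  have hf: "integrable M (\<lambda>x. (m x - g x) * f x)"
    by (rule integrable_mult_of_square_integrable) (use sq f in auto)
  have hm: "integrable M (\<lambda>x. (m x - g x) * m x)"
    by (rule integrable_mult_of_square_integrable) (use sq m in auto)
  have cross: "(\<integral>x. (m x - g x) * m x \<partial>M) = (\<integral>x. (m x - g x) * f x \<partial>M)"
    unfolding m_def by (rule real_cond_exp_intg(2)) (use hf in \<open>auto simp: m_def\<close>)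
  have "(f x - g x)\<^sup>2 = (f x - m x)\<^sup>2 + (m x - g x)\<^sup>2 + (2 * ((m x - g x) * f x) - 2 * ((m x - g x) * m x))"
    for x by (simp add: power2_eq_square algebra_simps)
  then show ?thesis
    using sq hf hm cross by simp
qed

section \<open>Jensen's inequality for the exponential\<close>

text \<open>
  The real conditional expectation is the difference of those of the positive and the negative
  part of \<open>f\<close>, and \<open>ennreal\<close> sends negative reals to \<open>0\<close>, so the right-hand side is that of the
  positive part. This carries lower bounds on \<open>E[f | F]\<close> over to the extended setting.
\<close>

lemma ennreal_real_cond_exp_le_nn_cond_exp:
  "ennreal (real_cond_exp M F f x) \<le> nn_cond_exp M F (\<lambda>x. ennreal (f x)) x"
proof -
  have "ennreal (real_cond_exp M F f x) \<le> ennreal (enn2real (nn_cond_exp M F (\<lambda>x. ennreal (f x)) x))"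
    unfolding real_cond_exp_def by (intro ennreal_leI) simp
  also have "\<dots> \<le> nn_cond_exp M F (\<lambda>x. ennreal (f x)) x"
    by (cases "nn_cond_exp M F (\<lambda>x. ennreal (f x)) x" rule: ennreal_cases) auto
  finally show ?thesis .
qed

text \<open>
  The tangent to \<open>exp\<close> is taken at the random point \<open>m = E[f | F]\<close>, in the form
  \<open>1 + (f - m) \<le> exp (f - m)\<close>. Normalizing by \<open>exp (- m)\<close> keeps the left-hand side \<open>h\<close> integrable,
  which the product \<open>exp m (1 + f - m)\<close> need not be, so its real conditional expectation is
  available and equals \<open>1\<close>.
\<close>

lemma (in finite_measure_subalgebra) exp_real_cond_exp_le_nn_cond_exp:
  assumes f: "integrable M f"
  shows "AE x in M. ennreal (exp (real_cond_exp M F f x)) \<le> nn_cond_exp M F (\<lambda>x. ennreal (exp (f x))) x"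
proof -
  define m where "m = real_cond_exp M F f"
  define h where "h = (\<lambda>x. 1 + f x - m x)"
  have [measurable]: "f \<in> borel_measurable M" "m \<in> borel_measurable F" "m \<in> borel_measurable M"
    using f by (auto simp: m_def)
  have m: "integrable M m"
    unfolding m_def by (rule real_cond_exp_int(1)[OF f])
  have [measurable]: "h \<in> borel_measurable M"
    unfolding h_def by measurable
  have h1: "AE x in M. real_cond_exp M F h x = 1"
  proof -
    have "AE x in M. real_cond_exp M F h x
        = real_cond_exp M F (\<lambda>x. 1 + f x) x - real_cond_exp M F m x"
      unfolding h_def by (rule real_cond_exp_diff) (use f m in auto)
    moreover have "AE x in M. real_cond_exp M F (\<lambda>x. 1 + f x) x
        = real_cond_exp M F (\<lambda>x. 1) x + m x"
      unfolding m_def by (rule real_cond_exp_add) (use f in auto)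
    moreover have "AE x in M. real_cond_exp M F (\<lambda>x. 1) x = 1"
      by (rule real_cond_exp_F_meas) auto
    moreover have "AE x in M. real_cond_exp M F m x = m x"
      by (rule real_cond_exp_F_meas) (use m in auto)
    ultimately show ?thesis by eventually_elim simp
  qed
  have tangent: "AE x in M. nn_cond_exp M F (\<lambda>x. ennreal (h x)) x
      \<le> nn_cond_exp M F (\<lambda>x. ennreal (exp (- m x)) * ennreal (exp (f x))) x"
  proof (rule nn_cond_exp_mono)
    have "h x \<le> exp (- m x) * exp (f x)" for x
      using exp_ge_add_one_self[of "f x - m x"] by (simp add: h_def exp_diff exp_minus field_simps)
    then show "AE x in M. ennreal (h x) \<le> ennreal (exp (- m x)) * ennreal (exp (f x))"
      by (simp add: ennreal_mult[symmetric] ennreal_leI)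
  qed auto
  have pull_out: "AE x in M. ennreal (exp (- m x)) * nn_cond_exp M F (\<lambda>x. ennreal (exp (f x))) x
      = nn_cond_exp M F (\<lambda>x. ennreal (exp (- m x)) * ennreal (exp (f x))) x"
    by (rule nn_cond_exp_prod) auto
  from h1 tangent pull_out show ?thesis
  proof eventually_elim
    case (elim x)
    let ?e = "nn_cond_exp M F (\<lambda>x. ennreal (exp (f x))) x"
    have "1 \<le> ennreal (exp (- m x)) * ?e"
      using ennreal_real_cond_exp_le_nn_cond_exp[of M F h x] elim by simp
    then have "ennreal (exp (m x)) * 1 \<le> ennreal (exp (m x)) * (ennreal (exp (- m x)) * ?e)"
      by (rule mult_left_mono) simp
    also have "\<dots> = ?e"
      by (simp add: mult.assoc[symmetric] ennreal_mult[symmetric] exp_minus)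
    finally show ?case by (simp add: m_def)
  qed
qed

section \<open>The logarithmic conditional expectation\<close>

lemma borel_measurable_vec_lambda:
  fixes f :: "'a \<Rightarrow> 'n::finite \<Rightarrow> real"
  assumes "\<And>i. (\<lambda>x. f x i) \<in> borel_measurable M"
  shows "(\<lambda>x. \<chi> i. f x i) \<in> borel_measurable M"
  unfolding borel_measurable_euclidean_space[of "\<lambda>x. \<chi> i. f x i"]
  using assms by (auto simp: Basis_vec_def inner_axis)

lemma borel_measurable_vec_nth:
  assumes "X \<in> borel_measurable M"
  shows "(\<lambda>x. X x $ i :: real) \<in> borel_measurable M"
  using assms by (rule borel_measurable_continuous_on[rotated]) (intro continuous_intros)

lemma subalgebra_sigma_gen:
  assumes "X \<in> borel_measurable M"
  shows "subalgebra M (sigma_gen M X)"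
  using assms unfolding subalgebra_def sigma_gen_def
  by (auto simp: sets_vimage_algebra2 measurable_def)

lemma Ln2_D:
  assumes "Z \<in> Ln2 M"
  shows "Z \<in> borel_measurable M"
    and "(\<lambda>\<omega>. ln (Z \<omega> $ i)) \<in> borel_measurable M"
    and "integrable M (\<lambda>\<omega>. (ln (Z \<omega> $ i))\<^sup>2)"
    and "AE \<omega> in M. \<forall>i. 0 < Z \<omega> $ i"
proof -
  show "Z \<in> borel_measurable M" "integrable M (\<lambda>\<omega>. (ln (Z \<omega> $ i))\<^sup>2)" "AE \<omega> in M. \<forall>i. 0 < Z \<omega> $ i"
    using assms by (auto simp: Ln2_def pos_rv_def)
  then show "(\<lambda>\<omega>. ln (Z \<omega> $ i)) \<in> borel_measurable M"
    using borel_measurable_vec_nth by (intro borel_measurable_ln) auto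
qed

lemma log_cond_exp_measurable:
  "log_cond_exp M Y X \<in> borel_measurable (sigma_gen M X)"
  unfolding log_cond_exp_def by (intro borel_measurable_vec_lambda) measurable

lemma ln_log_cond_exp:
  "ln (log_cond_exp M Y X \<omega> $ i) = real_cond_exp M (sigma_gen M X) (\<lambda>\<omega>. ln (Y \<omega> $ i)) \<omega>"
  by (simp add: log_cond_exp_def)

lemma log_cond_exp_in_Ln2:
  assumes "prob_space M" and "X \<in> borel_measurable M" and Y: "Y \<in> Ln2 M"
  shows "log_cond_exp M Y X \<in> Ln2 M"
proof -
  interpret prob_space M by fact
  interpret finite_measure_subalgebra M "sigma_gen M X"
    by unfold_locales (rule subalgebra_sigma_gen[OF assms(2)])
  have "log_cond_exp M Y X \<in> borel_measurable M"
    using measurable_from_subalg[OF subalg log_cond_exp_measurable] .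
  moreover have "integrable M (\<lambda>\<omega>. (ln (log_cond_exp M Y X \<omega> $ i))\<^sup>2)" for i
    unfolding ln_log_cond_exp
    by (rule integrable_real_cond_exp_square[OF Ln2_D(2,3)[OF Y]])
  ultimately show ?thesis
    by (simp add: Ln2_def pos_rv_def) (simp add: log_cond_exp_def)
qed

text \<open>
  Membership in \<open>Ln2\<close> makes each summand integrable, so that the integral of the sum splits.
\<close>

lemma log_dist_square:
  assumes "Y \<in> Ln2 M" "Z \<in> Ln2 M"
  shows "(log_dist M Y Z)\<^sup>2 = (\<Sum>i\<in>UNIV. \<integral>\<omega>. (ln (Y \<omega> $ i) - ln (Z \<omega> $ i))\<^sup>2 \<partial>M)"
proof -
  have "integrable M (\<lambda>\<omega>. (ln (Y \<omega> $ i) - ln (Z \<omega> $ i))\<^sup>2)" for i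
    by (intro integrable_square_diff Ln2_D assms)
  then show ?thesis
    by (simp add: log_dist_def sum_nonneg)
qed

lemma log_dist_pythagoras:
  assumes "prob_space M" and X: "X \<in> borel_measurable M" and Y: "Y \<in> Ln2 M"
    and Z: "Z \<in> Ln2 M" "Z \<in> borel_measurable (sigma_gen M X)"
  shows "(log_dist M Y Z)\<^sup>2
    = (log_dist M Y (log_cond_exp M Y X))\<^sup>2 + (log_dist M (log_cond_exp M Y X) Z)\<^sup>2"
proof -
  interpret prob_space M by fact
  interpret finite_measure_subalgebra M "sigma_gen M X"
    by unfold_locales (rule subalgebra_sigma_gen[OF X])
  have "(\<lambda>\<omega>. ln (Z \<omega> $ i)) \<in> borel_measurable (sigma_gen M X)" for i
    using borel_measurable_vec_nth[OF Z(2)] by (rule borel_measurable_ln)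
  then have "(\<integral>\<omega>. (ln (Y \<omega> $ i) - ln (Z \<omega> $ i))\<^sup>2 \<partial>M)
      = (\<integral>\<omega>. (ln (Y \<omega> $ i) - ln (log_cond_exp M Y X \<omega> $ i))\<^sup>2 \<partial>M)
        + (\<integral>\<omega>. (ln (log_cond_exp M Y X \<omega> $ i) - ln (Z \<omega> $ i))\<^sup>2 \<partial>M)" for i
    unfolding ln_log_cond_exp
    by (intro real_cond_exp_pythagoras Ln2_D[OF Y] Ln2_D[OF Z(1)])
  then show ?thesis
    by (simp add: log_dist_square Y Z(1) log_cond_exp_in_Ln2[OF assms(1) X Y] sum.distrib)
qed

text \<open>
  The logarithm is injective only on the positive reals, so this needs the positivity of the
  coordinates, which holds almost everywhere.
\<close>

lemma log_dist_eq_0_imp_AE_eq: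
  assumes Y: "Y \<in> Ln2 M" and Z: "Z \<in> Ln2 M" and "log_dist M Y Z = 0"
  shows "AE \<omega> in M. Y \<omega> = Z \<omega>"
proof -
  let ?d = "\<lambda>i \<omega>. (ln (Y \<omega> $ i) - ln (Z \<omega> $ i))\<^sup>2"
  have int: "integrable M (?d i)" for i
    by (intro integrable_square_diff Ln2_D assms)
  have "(\<Sum>i\<in>UNIV. \<integral>\<omega>. ?d i \<omega> \<partial>M) = 0"
    using log_dist_square[OF Y Z] assms(3) by simp
  then have "(\<integral>\<omega>. ?d i \<omega> \<partial>M) = 0" for i
    by (subst (asm) sum_nonneg_eq_0_iff) auto
  then have "AE \<omega> in M. ?d i \<omega> = 0" for i
    using integral_nonneg_eq_0_iff_AE[OF int] by simp
  then have "AE \<omega> in M. \<forall>i. ?d i \<omega> = 0"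
    by (simp add: AE_all_countable)
  with Ln2_D(4)[OF Y] Ln2_D(4)[OF Z] show ?thesis
    by eventually_elim (simp add: vec_eq_iff)
qed

theorem proposition2p2:
  fixes M :: "'a measure" and X Y :: "'a \<Rightarrow> real ^ 'n"
  assumes "prob_space M"
    and "Y \<in> Ln2 M" and "X \<in> Ln2 M"
  shows "is_arg_min (log_dist M Y) (\<lambda>Z. Z \<in> Ln2 M \<and> Z \<in> borel_measurable (sigma_gen M X))
           (log_cond_exp M Y X)
       \<and> (\<forall>Z. is_arg_min (log_dist M Y) (\<lambda>Z. Z \<in> Ln2 M \<and> Z \<in> borel_measurable (sigma_gen M X)) Z
            \<longrightarrow> (AE \<omega> in M. Z \<omega> = log_cond_exp M Y X \<omega>))
       \<and> (AE \<omega> in M. \<forall>i. ennreal (log_cond_exp M Y X \<omega> $ i)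
            \<le> nn_cond_exp M (sigma_gen M X) (\<lambda>\<omega>'. ennreal (Y \<omega>' $ i)) \<omega>)"
proof -
  interpret prob_space M by fact
  have X: "X \<in> borel_measurable M"
    by (rule Ln2_D(1)[OF assms(3)])
  interpret finite_measure_subalgebra M "sigma_gen M X"
    by unfold_locales (rule subalgebra_sigma_gen[OF X])
  let ?E = "log_cond_exp M Y X"
  let ?P = "\<lambda>Z. Z \<in> Ln2 M \<and> Z \<in> borel_measurable (sigma_gen M X)"
  note pythagoras = log_dist_pythagoras[OF assms(1) X assms(2)]
  have nonneg: "0 \<le> log_dist M U V" for U V :: "'a \<Rightarrow> real ^ 'n"
    by (simp add: log_dist_def sum_nonneg)
  have E: "?P ?E"
    using log_cond_exp_in_Ln2[OF assms(1) X assms(2)] log_cond_exp_measurable by blast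
  have "log_dist M Y ?E \<le> log_dist M Y Z" if "?P Z" for Z
  proof (rule power2_le_imp_le)
    show "(log_dist M Y ?E)\<^sup>2 \<le> (log_dist M Y Z)\<^sup>2"
      using pythagoras[of Z] that by simp
  qed (rule nonneg)
  with E have min: "is_arg_min (log_dist M Y) ?P ?E"
    unfolding is_arg_min_def by (meson not_le)
  have unique: "AE \<omega> in M. Z \<omega> = ?E \<omega>" if Z: "is_arg_min (log_dist M Y) ?P Z" for Z
  proof -
    have PZ: "?P Z" and "log_dist M Y Z \<le> log_dist M Y ?E"
      using Z E by (auto simp: is_arg_min_def not_less)
    then have "(log_dist M Y Z)\<^sup>2 \<le> (log_dist M Y ?E)\<^sup>2"
      using nonneg by (intro power_mono) auto
    then have "log_dist M ?E Z = 0"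
      using pythagoras[of Z] PZ by simp
    then have "AE \<omega> in M. ?E \<omega> = Z \<omega>"
      using E PZ by (intro log_dist_eq_0_imp_AE_eq) auto
    then show ?thesis by eventually_elim simp
  qed
  have "AE \<omega> in M. ennreal (?E \<omega> $ i)
      \<le> nn_cond_exp M (sigma_gen M X) (\<lambda>\<omega>'. ennreal (Y \<omega>' $ i)) \<omega>" for i
  proof -
    note lnY = Ln2_D(2,3)[OF assms(2), of i]
    have [measurable]: "(\<lambda>\<omega>. Y \<omega> $ i) \<in> borel_measurable M"
      by (rule borel_measurable_vec_nth[OF Ln2_D(1)[OF assms(2)]])
    have "AE \<omega> in M. nn_cond_exp M (sigma_gen M X) (\<lambda>\<omega>. ennreal (exp (ln (Y \<omega> $ i)))) \<omega>
        = nn_cond_exp M (sigma_gen M X) (\<lambda>\<omega>. ennreal (Y \<omega> $ i)) \<omega>"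
    proof (rule nn_cond_exp_cong)
      show "AE \<omega> in M. ennreal (exp (ln (Y \<omega> $ i))) = ennreal (Y \<omega> $ i)"
        using Ln2_D(4)[OF assms(2)] by eventually_elim simp
    qed auto
    moreover have "AE \<omega> in M. ennreal (?E \<omega> $ i)
        \<le> nn_cond_exp M (sigma_gen M X) (\<lambda>\<omega>. ennreal (exp (ln (Y \<omega> $ i)))) \<omega>"
      using exp_real_cond_exp_le_nn_cond_exp[OF square_integrable_imp_integrable[OF lnY]]
      by (simp add: log_cond_exp_def)
    ultimately show ?thesis by eventually_elim simp
  qed
  then have "AE \<omega> in M. \<forall>i. ennreal (?E \<omega> $ i)
      \<le> nn_cond_exp M (sigma_gen M X) (\<lambda>\<omega>'. ennreal (Y \<omega>' $ i)) \<omega>"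
    by (simp add: AE_all_countable)
  with min unique show ?thesis by blast
qed

end
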